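(* Let $q$ be an odd prime power with $q\equiv 1\pmod 3$, let $m=(q-1)/3$, and let $\gamma$ be a generator of the multiplicative group $\mathbf{F}_q^*$. For $k\in\{0,1,\dots,m-1\}$ define $a,b,c,d,e,f\in\mathbf{F}_q^*$ by $$a=\frac{2\gamma^{3k+2}}{3},\quad b=\frac{\gamma^{m}}{3},\quad c=\frac{-\gamma^{m+3k+2}}{3},\quad d=\frac{\gamma^{2m}}{3},\quad e=\frac{-\gamma^{2m+3k+2}}{3},\quad f=\frac{1}{3}.$$ Then the polynomial $$g(x)=ax^{3m-1}+bx^{2m+1}+cx^{2m-1}+dx^{m+1}+ex^{m-1}+fx$$ is a permutation polynomial over $\mathbf{F}_q$, and the permutation of $\mathbf{F}_q$ it induces is an involution with exactly $m+1$ fixed points.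
   Context: $\mathbf{F}_q$ denotes the finite field with $q$ elements. A permutation polynomial over $\mathbf{F}_q$ is a polynomial $g\in\mathbf{F}_q[x]$ whose associated map $\mathbf{F}_q\to\mathbf{F}_q$, $x\mapsto g(x)$, is a bijection; it is involutory if $g(g(x))=x$ for all $x\in\mathbf{F}_q$. *)

theory Defs
  imports "HOL-Library.Cardinality" "HOL-Computational_Algebra.Polynomial"
    "HOL-Number_Theory.Cong" "HOL-Number_Theory.Prime_Powers"
begin

definition mult_generator :: "'a::field \<Rightarrow> bool" where
  "mult_generator \<gamma> \<longleftrightarrow> \<gamma> \<noteq> 0 \<and> range (\<lambda>i::int. \<gamma> powi i) = UNIV - {0}"

definition permutation_poly :: "'a::{field,finite} poly \<Rightarrow> bool" where
  "permutation_poly g \<longleftrightarrow> bij (poly g)"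

definition involutory_poly :: "'a::{field,finite} poly \<Rightarrow> bool" where
  "involutory_poly g \<longleftrightarrow> (\<forall>x. poly g (poly g x) = x)"

end

theory Submission imports Defs begin

text \<open>Put \<open>w = \<gamma>^m\<close>, a primitive cube root of unity, and \<open>B = \<gamma>^(3k+2)\<close>. For \<open>x \<noteq> 0\<close> the value
  \<open>s = x^m\<close> lies in \<open>{1, w, w\<^sup>2}\<close>, and
  \<open>g(x) = (2 - t) B / (3x) + (1 + t) x / 3\<close> with \<open>t = w s\<^sup>2 + w\<^sup>2 s\<close>.
  Now \<open>t = 2\<close> if \<open>s = w\<close> and \<open>t = -1\<close> otherwise, so \<open>g\<close> fixes the \<open>m\<close> elements with \<open>x^m = w\<close> and
  acts as \<open>x \<mapsto> B / x\<close> on the rest. Since \<open>B^m = w\<^sup>2\<close>, this inversion exchanges the classes \<open>s = 1\<close>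
  and \<open>s = w\<^sup>2\<close>, hence has no fixed point there.\<close>

text \<open>Multiplication by \<open>x\<close> permutes the nonzero elements, so their product is
  unchanged by a factor \<open>x ^ card ?S\<close>; being nonzero, it cancels.\<close>

lemma power_CARD_minus_1_eq_1:
  fixes x :: "'a::{field,finite}"
  assumes "x \<noteq> 0"
  shows "x ^ (CARD('a) - 1) = 1"
proof -
  let ?S = "UNIV - {0::'a}"
  have "bij_betw ((*) x) ?S ?S"
    by (rule bij_betw_byWitness[where f' = "\<lambda>y. y / x"]) (use assms in auto)
  then have "\<Prod>?S = (\<Prod>y\<in>?S. x * y)"
    using prod.reindex_bij_betw[of "(*) x" ?S ?S "\<lambda>y. y"] by simp
  also have "\<dots> = x ^ card ?S * \<Prod>?S"
    by (simp add: prod.distrib)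
  finally have "x ^ card ?S = 1"
    by simp
  then show ?thesis
    by (simp add: card_Diff_singleton)
qed

text \<open>An integer exponent may be reduced modulo \<open>?n = CARD('a) - 1\<close>, so the
  \<open>?n\<close> powers with exponent below \<open>?n\<close> already cover the \<open>?n\<close>
  nonzero elements. A surjection between finite sets of equal size is injective.\<close>

lemma mult_generator_bij_betw:
  fixes \<gamma> :: "'a::{field,finite}"
  assumes "mult_generator \<gamma>"
  shows "bij_betw (\<lambda>i. \<gamma> ^ i) {..<CARD('a) - 1} (UNIV - {0})"
proof -
  let ?n = "CARD('a) - 1"
  have nz: "\<gamma> \<noteq> 0" and range: "range (\<lambda>i::int. \<gamma> powi i) = UNIV - {0}"
    using assms by (auto simp: mult_generator_def)
  have one: "\<gamma> ^ ?n = 1"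
    using nz by (rule power_CARD_minus_1_eq_1)
  have card: "card (UNIV - {0::'a}) = ?n"
    by (simp add: card_Diff_singleton)
  have npos: "?n > 0"
    using card_gt_0_iff[of "UNIV - {0::'a}"] card nz by auto
  have "x \<in> (\<lambda>i. \<gamma> ^ i) ` {..<?n}" if "x \<noteq> 0" for x
  proof -
    obtain i :: int where x: "x = \<gamma> powi i"
      using range \<open>x \<noteq> 0\<close> by auto
    let ?r = "nat (i mod int ?n)"
    have "i = int ?n * (i div int ?n) + int ?r"
      using npos by simp
    then have "x = \<gamma> powi (int ?n * (i div int ?n)) * \<gamma> powi (int ?r)"
      using nz x by (metis power_int_add)
    then have "x = \<gamma> ^ ?r"
      using one by (simp only: power_int_mult power_int_of_nat) simp
    moreover have "?r < ?n"
      using npos by (simp add: nat_less_iff)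
    ultimately show ?thesis
      by blast
  qed
  then have "(\<lambda>i. \<gamma> ^ i) ` {..<?n} = UNIV - {0}"
    using nz by auto
  then show ?thesis
    by (simp add: bij_betw_def eq_card_imp_inj_on card)
qed

theorem theorem2p5:
  fixes \<gamma> a b c d e f :: "'a::{field,finite}" and g :: "'a poly" and q m k :: nat
  assumes "primepow q" and "odd q" and "[q = 1] (mod 3)"
    and "CARD('a) = q"
    and "m = (q - 1) div 3"
    and "mult_generator \<gamma>"
    and "k \<in> {0..<m}"
    and "a = 2 * \<gamma> ^ (3 * k + 2) / 3"
    and "b = \<gamma> ^ m / 3"
    and "c = - (\<gamma> ^ (m + 3 * k + 2)) / 3"
    and "d = \<gamma> ^ (2 * m) / 3"
    and "e = - (\<gamma> ^ (2 * m + 3 * k + 2)) / 3"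
    and "f = 1 / 3"
    and "g = Polynomial.monom a (3 * m - 1) + Polynomial.monom b (2 * m + 1) + Polynomial.monom c (2 * m - 1)
           + Polynomial.monom d (m + 1) + Polynomial.monom e (m - 1) + Polynomial.monom f 1"
  shows "{a, b, c, d, e, f} \<subseteq> UNIV - {0} \<and>
         permutation_poly g \<and> involutory_poly g \<and> card {x. poly g x = x} = m + 1"
proof -
  have "3 dvd q - 1"
    using assms(3) by (simp add: cong_def) presburger
  then have q: "CARD('a) - 1 = 3 * m"
    using assms(4,5) by simp
  have "m > 0"
    using assms(7) by simp
  have "even m"
    using q assms(2,4) by presburger
  \<comment> \<open>This makes the exponent \<open>m - 1\<close> positive; otherwise
    \<open>g\<close> would have the constant term \<open>e\<close> and would not vanish at
    0.\<close>
  then have m2: "m \<ge> 2"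
    using \<open>m > 0\<close> by auto
  have nz: "\<gamma> \<noteq> 0"
    using assms(6) by (simp add: mult_generator_def)
  have bij: "bij_betw (\<lambda>i. \<gamma> ^ i) {..<3 * m} (UNIV - {0})"
    using mult_generator_bij_betw[OF assms(6)] q by simp
  have inj: "i = j" if "\<gamma> ^ i = \<gamma> ^ j" "i < 3 * m" "j < 3 * m" for i j
    using bij that by (auto simp: bij_betw_def inj_on_def)
  have fermat: "x ^ (3 * m) = 1" if "x \<noteq> 0" for x :: 'a
    using power_CARD_minus_1_eq_1[OF that] q by simp
  define w where "w = \<gamma> ^ m"
  define B where "B = \<gamma> ^ (3 * k + 2)"
  have w3: "w ^ 3 = 1"
    using fermat[OF nz] by (simp add: w_def mult.commute flip: power_mult)
  have w1: "w \<noteq> 1"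
    using inj[of m 0] \<open>m > 0\<close> by (auto simp: w_def)
  have B0: "B \<noteq> 0"
    using nz by (simp add: B_def)
  have "(w - 1) * (1 + w + w\<^sup>2) = 0"
    using w3 by (simp add: algebra_simps power2_eq_square power3_eq_cube)
  then have wsum: "1 + w + w\<^sup>2 = 0"
    using w1 by simp
  \<comment> \<open>In characteristic 3, \<open>1 + w + w\<^sup>2\<close> is the square of
    \<open>w - 1\<close>, which would force \<open>w = 1\<close>.\<close>
  have three: "(3::'a) \<noteq> 0"
  proof
    assume three0: "(3::'a) = 0"
    have "(w - 1)\<^sup>2 = (1 + w + w\<^sup>2) - 3 * w"
      by (simp add: power2_eq_square algebra_simps)
    then show False
      using wsum three0 w1 by simp
  qed
  \<comment> \<open>The power of \<open>\<gamma>\<close> with exponent \<open>3 * m / 2\<close>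
    squares to 1. In characteristic 2 the only square root of 1 is 1, but this exponent lies
    strictly between 0 and \<open>3 * m\<close>.\<close>
  have two: "(2::'a) \<noteq> 0"
  proof
    assume two0: "(2::'a) = 0"
    define y where "y = \<gamma> ^ (3 * (m div 2))"
    have "y\<^sup>2 = \<gamma> ^ (3 * m)"
      using \<open>even m\<close> by (auto simp: y_def simp flip: power_mult elim!: evenE)
    then have "(y - 1)\<^sup>2 = 2 * (1 - y)"
      using fermat[OF nz] by (simp add: power2_eq_square algebra_simps)
    then have "y = 1"
      using two0 by simp
    then show False
      using inj[of "3 * (m div 2)" 0] m2 by (auto simp: y_def)
  qed

  have power_m: "(\<gamma> ^ i) ^ m = w ^ (i mod 3)" for i
  proof -
    have "(\<gamma> ^ i) ^ m = w ^ (3 * (i div 3) + i mod 3)"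
      by (simp add: w_def mult.commute flip: power_mult)
    also have "\<dots> = w ^ (i mod 3)"
      by (simp only: power_add power_mult w3) simp
    finally show ?thesis .
  qed
  have w2w: "w\<^sup>2 \<noteq> w" and w21: "w\<^sup>2 \<noteq> 1"
    using w1 w3 by (auto simp: power2_eq_square power3_eq_cube)
  have Bm: "B ^ m = w\<^sup>2"
  proof -
    have "(3 * k + 2) mod 3 = 2"
      by presburger
    then show ?thesis
      by (simp only: B_def power_m)
  qed
  have cases: "x ^ m = 1 \<or> x ^ m = w \<or> x ^ m = w\<^sup>2" if "x \<noteq> 0" for x
  proof -
    obtain i where "x = \<gamma> ^ i"
      using bij \<open>x \<noteq> 0\<close> by (auto simp: bij_betw_def)
    moreover have "i mod 3 = 0 \<or> i mod 3 = 1 \<or> i mod 3 = 2"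
      by linarith
    ultimately show ?thesis
      using power_m[of i] by auto
  qed

  have g0: "poly g 0 = 0"
    using m2 by (simp add: assms(14) poly_monom zero_power)
  \<comment> \<open>Keeping \<open>t\<close> as a variable lets the formula be instantiated directly
    at the two values 2 and -1. The first summand collects \<open>a\<close>, \<open>c\<close>,
    \<open>e\<close>, the second \<open>b\<close>, \<open>d\<close>, \<open>f\<close>.\<close>
  have g: "poly g x = (2 - t) * B / (3 * x) + (1 + t) * x / 3"
    if "x \<noteq> 0" "t = w * (x ^ m)\<^sup>2 + w\<^sup>2 * x ^ m" for x t
  proof -
    have pred: "x ^ (n - Suc 0) = x ^ n / x" if "n > 0" for n
      using that \<open>x \<noteq> 0\<close> by (simp add: power_diff)
    have powers: "x ^ (3 * m - 1) = 1 / x" "x ^ (2 * m - 1) = (x ^ m)\<^sup>2 / x"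
      "x ^ (m - 1) = x ^ m / x" "x ^ (2 * m + 1) = (x ^ m)\<^sup>2 * x" "x ^ (m + 1) = x ^ m * x"
      using \<open>m > 0\<close> fermat[OF \<open>x \<noteq> 0\<close>]
      by (simp_all add: pred mult.commute flip: power_mult)
    have coeffs: "a = 2 * B / 3" "b = w / 3" "c = - (w * B) / 3" "d = w\<^sup>2 / 3" "e = - (w\<^sup>2 * B) / 3"
      unfolding assms(8-12) B_def w_def
      by (simp_all add: power_add add.assoc mult.commute flip: power_mult)
    show ?thesis
      unfolding assms(14) that(2) poly_add poly_monom powers coeffs assms(13)
      by (simp add: algebra_simps add_divide_distrib diff_divide_distrib)
  qed
  have g_fix: "poly g x = x" if "x ^ m = w" for x
  proof (cases "x = 0")
    case False
    \<comment> \<open>Both summands equal \<open>w ^ 3\<close>.\<close>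
    have "w * (x ^ m)\<^sup>2 + w\<^sup>2 * x ^ m = 2"
      using w3 that by (simp add: power2_eq_square power3_eq_cube mult.assoc)
    then show ?thesis
      using g[OF False, of 2] three by simp
  qed (simp add: g0)
  have g_inv: "poly g x = B / x" if "x \<noteq> 0" "x ^ m \<noteq> w" for x
  proof -
    \<comment> \<open>For \<open>x ^ m = w\<^sup>2\<close> the summands are \<open>w ^ 5\<close> and
      \<open>w ^ 4\<close>, so the two terms merely trade places.\<close>
    have "w * (x ^ m)\<^sup>2 + w\<^sup>2 * x ^ m = w + w\<^sup>2"
    proof (cases "x ^ m = 1")
      case False
      then have "x ^ m = w\<^sup>2"
        using cases that by blast
      moreover have "w * (w\<^sup>2)\<^sup>2 + w\<^sup>2 * w\<^sup>2 = w ^ 3 * (w\<^sup>2 + w)"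
        by (simp add: power2_eq_square power3_eq_cube algebra_simps)
      ultimately show ?thesis
        using w3 by simp
    qed simp
    also have "\<dots> = - 1"
      using wsum by (simp add: eq_neg_iff_add_eq_0 ac_simps)
    finally show ?thesis
      using g[OF that(1), of "- 1"] three by simp
  qed
  \<comment> \<open>The first claim allows \<open>g_inv\<close> to be applied a second time, at
    \<open>B / x\<close>; the second gives \<open>B / x \<noteq> x\<close>.\<close>
  have swap: "(B / x) ^ m \<noteq> w" "(B / x) ^ m \<noteq> x ^ m" if "x \<noteq> 0" "x ^ m \<noteq> w" for x
  proof -
    have "x ^ m = 1 \<or> x ^ m = w\<^sup>2"
      using cases that by blast
    then have "(B / x) ^ m = w\<^sup>2 \<and> x ^ m = 1 \<or> (B / x) ^ m = 1 \<and> x ^ m = w\<^sup>2"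
      using that(1) nz by (auto simp: power_divide Bm w_def)
    then show "(B / x) ^ m \<noteq> w" "(B / x) ^ m \<noteq> x ^ m"
      using w1 w2w w21 by auto
  qed

  have invol: "poly g (poly g x) = x" for x
  proof (cases "x = 0 \<or> x ^ m = w")
    case True
    then show ?thesis
      using g0 g_fix by auto
  next
    case False
    then show ?thesis
      using g_inv[of x] g_inv[of "B / x"] swap(1)[of x] B0 by simp
  qed
  \<comment> \<open>The nonzero fixed points are the solutions of \<open>x ^ m = w\<close>, that is,
    the powers of \<open>\<gamma>\<close> whose exponent is 1 modulo 3; exactly \<open>m\<close>
    such exponents lie below \<open>3 * m\<close>.\<close>
  have "{x. poly g x = x} = insert 0 ((\<lambda>j. \<gamma> ^ (3 * j + 1)) ` {..<m})"
  proof (intro equalityI subsetI)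
    fix x assume "x \<in> {x. poly g x = x}"
    then have fixed: "poly g x = x" by simp
    show "x \<in> insert 0 ((\<lambda>j. \<gamma> ^ (3 * j + 1)) ` {..<m})"
    proof (cases "x = 0")
      case False
      then have xm: "x ^ m = w"
        using g_inv[of x] swap(2)[of x] fixed by metis
      obtain i where i: "x = \<gamma> ^ i" "i < 3 * m"
        using bij False by (auto simp: bij_betw_def)
      have "i mod 3 = 0 \<or> i mod 3 = 1 \<or> i mod 3 = 2"
        by linarith
      then have "i mod 3 = 1"
        using power_m[of i] xm i(1) w1 w2w by auto
      then obtain j where "i = 3 * j + 1"
        by (metis mult_div_mod_eq)
      then show ?thesis
        using i by auto
    qed simp
  next
    fix x assume "x \<in> insert 0 ((\<lambda>j. \<gamma> ^ (3 * j + 1)) ` {..<m})"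
    then show "x \<in> {x. poly g x = x}"
    proof
      assume "x \<in> (\<lambda>j. \<gamma> ^ (3 * j + 1)) ` {..<m}"
      then obtain j where "x = \<gamma> ^ (3 * j + 1)"
        by blast
      then have "x ^ m = w ^ ((3 * j + 1) mod 3)"
        by (simp only: power_m)
      also have "(3 * j + 1) mod 3 = 1"
        by presburger
      finally show ?thesis
        using g_fix by simp
    qed (simp add: g0)
  qed
  moreover have "inj_on (\<lambda>j. \<gamma> ^ (3 * j + 1)) {..<m}"
  proof (rule inj_onI)
    fix i j
    assume "i \<in> {..<m}" "j \<in> {..<m}" "\<gamma> ^ (3 * i + 1) = \<gamma> ^ (3 * j + 1)"
    then show "i = j"
      using inj[of "3 * i + 1" "3 * j + 1"] by simp
  qed
  moreover have "0 \<notin> (\<lambda>j. \<gamma> ^ (3 * j + 1)) ` {..<m}"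
    using nz by auto
  ultimately have fixed: "card {x. poly g x = x} = m + 1"
    by (simp add: card_image)
  have "bij (poly g)"
    using invol by (rule involuntory_imp_bij)
  \<comment> \<open>Division by zero yields 0, so the denominators require \<open>three\<close>; the
    factor 2 in \<open>a\<close> requires \<open>two\<close>.\<close>
  moreover have "{a, b, c, d, e, f} \<subseteq> UNIV - {0}"
    using nz two three by (simp add: assms(8-13))
  ultimately show ?thesis
    using invol fixed by (simp add: permutation_poly_def involutory_poly_def)
qed

end
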